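(* Let $\mathbf g,\mathbf h,\mathbf i,\mathbf j,\mathbf k,\mathbf l,\mathbf m,\mathbf q,\mathbf r\in E$ with $(\mathbf g,\mathbf h,\mathbf i),(\mathbf j,\mathbf k,\mathbf l),(\mathbf m,\mathbf q,\mathbf r)\in\mathbb{P}$. Then $(\mathbf g,[\mathbf g,\mathbf h,\mathbf i,\mathbf k,\mathbf l],\mathbf l)\in\mathbb{P}$, and the coefficient of $B_{\mathbf m,\mathbf q,\mathbf r}$ in the expansion of $B_{\mathbf g,\mathbf h,\mathbf i}B_{\mathbf j,\mathbf k,\mathbf l}$ with respect to the basis $\{B_{\mathbf a,\mathbf b,\mathbf c}:(\mathbf a,\mathbf b,\mathbf c)\in\mathbb{P}\}$ of $\mathbb{T}$ equals $\delta_{\mathbf i,\mathbf j}\delta_{\mathbf m,\mathbf g}\delta_{\mathbf q,[\mathbf g,\mathbf h,\mathbf i,\mathbf k,\mathbf l]}\delta_{\mathbf r,\mathbf l}\,\overline{k_{\mathbf h\cap\mathbf i\cap\mathbf k}}$.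
   Context: Let $\mathbb{F}$ be a field; $\overline m$ is the image in $\mathbb{F}$ of an integer $m$ and $\delta$ is the Kronecker delta with values in $\mathbb{F}$. Let $n\ge 1$ and let $U_1,\dots,U_n$ be finite sets with $|U_h|\ge 2$. Put $X=U_1\times\cdots\times U_n$ and $E=\{0,1\}^n$. For $\mathbf g\in E$ let $S(\mathbf g)=\{a:\mathbf g_a=1\}$; $\mathbf g\cap\mathbf h\cap\mathbf i$ is the element of $E$ with support $S(\mathbf g)\cap S(\mathbf h)\cap S(\mathbf i)$. For $V\subseteq\{1,\dots,n\}$ let $V^\circ=\{a\in V:|U_a|>2\}$. Let $R_{\mathbf g}=\{(\mathbf y,\mathbf z)\in X\times X:\ \mathbf y_a\neq\mathbf z_a\iff\mathbf g_a=1\}$ and $k_{\mathbf g}=\prod_{a\in S(\mathbf g)}(|U_a|-1)$ ($k_{\mathbf 0}=1$). Let $A_{\mathbf g}\in\mathrm{M}_X(\mathbb{F})$ be the $\{0,1\}$ adjacency matrix of $R_{\mathbf g}$. Fix $\mathbf x\in X$ and let $E^*_{\mathbf g}$ be the diagonal matrix with $(\mathbf y,\mathbf y)$-entry $1$ iff $(\mathbf x,\mathbf y)\in R_{\mathbf g}$, else $0$. $\mathbb{T}$ is the $\mathbb{F}$-subalgebra of $\mathrm{M}_X(\mathbb{F})$ generated by all $A_{\mathbf g},E^*_{\mathbf g}$. Let $\mathbb{P}$ be the set of $(\mathbf a,\mathbf b,\mathbf c)\in E^3$ with $S(\mathbf a)\triangle S(\mathbf c)\subseteq S(\mathbf b)\subseteq(S(\mathbf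 a)\triangle S(\mathbf c))\cup(S(\mathbf a)\cap S(\mathbf c))^\circ$. For $(\mathbf g,\mathbf h,\mathbf i)\in\mathbb{P}$ let $B_{\mathbf g,\mathbf h,\mathbf i}=\sum_{\mathbf j}E^*_{\mathbf g}A_{\mathbf j}E^*_{\mathbf i}$ over all $\mathbf j\in E$ with $S(\mathbf g)\triangle S(\mathbf i)\subseteq S(\mathbf j)\subseteq S(\mathbf h)$; these form an $\mathbb{F}$-basis of $\mathbb{T}$. For $\mathbf g,\mathbf h,\mathbf i,\mathbf j,\mathbf k\in E$, $[\mathbf g,\mathbf h,\mathbf i,\mathbf j,\mathbf k]$ denotes the element of $E$ with support $(S(\mathbf g)\triangle S(\mathbf k))\cup\big((S(\mathbf g)\cap S(\mathbf k))^\circ\setminus S(\mathbf i)\big)\cup\big((S(\mathbf h)\cup S(\mathbf j))\cap(S(\mathbf g)\cap S(\mathbf i)\cap S(\mathbf k))^\circ\big)$. *)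

theory Defs
  imports Complex_Main "HOL-Library.FuncSet" "HOL-Library.Function_Algebras"
begin

text \<open>
  A square matrix with rows and columns indexed by \<open>X\<close> is a function of two arguments that
  vanishes outside \<open>X \<times> X\<close>. Addition is pointwise; the pointwise \<open>*\<close> on
  functions is not the matrix product.
\<close>

definition mat_carrier :: "'p set \<Rightarrow> ('p \<Rightarrow> 'p \<Rightarrow> 'f::field) set" where
  "mat_carrier X = {M. \<forall>y z. M y z \<noteq> 0 \<longrightarrow> y \<in> X \<and> z \<in> X}"

definition mat_one :: "'p set \<Rightarrow> 'p \<Rightarrow> 'p \<Rightarrow> 'f::field" where
  "mat_one X = (\<lambda>y z. of_bool (y \<in> X \<and> y = z))"

definition mat_mul ::
    "'p set \<Rightarrow> ('p \<Rightarrow> 'p \<Rightarrow> 'f::field) \<Rightarrow> ('p \<Rightarrow> 'p \<Rightarrow> 'f) \<Rightarrow> 'p \<Rightarrow> 'p \<Rightarrow> 'f" where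
  "mat_mul X M N = (\<lambda>y z. \<Sum>w\<in>X. M y w * N w z)"

definition mat_scale :: "'f::field \<Rightarrow> ('p \<Rightarrow> 'p \<Rightarrow> 'f) \<Rightarrow> 'p \<Rightarrow> 'p \<Rightarrow> 'f" where
  "mat_scale c M = (\<lambda>y z. c * M y z)"

global_interpretation mat: vector_space "mat_scale :: 'f::field \<Rightarrow> ('p \<Rightarrow> 'p \<Rightarrow> 'f) \<Rightarrow> _"
  by unfold_locales (auto simp: mat_scale_def fun_eq_iff algebra_simps)

definition mat_subalgebra :: "'p set \<Rightarrow> ('p \<Rightarrow> 'p \<Rightarrow> 'f::field) set \<Rightarrow> bool" where
  "mat_subalgebra X S \<longleftrightarrow>
     S \<subseteq> mat_carrier X \<and> mat.subspace S \<and> mat_one X \<in> S \<and>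
     (\<forall>M\<in>S. \<forall>N\<in>S. mat_mul X M N \<in> S)"

definition generated_subalgebra ::
    "'p set \<Rightarrow> ('p \<Rightarrow> 'p \<Rightarrow> 'f::field) set \<Rightarrow> ('p \<Rightarrow> 'p \<Rightarrow> 'f) set" where
  "generated_subalgebra X G = \<Inter>{S. mat_subalgebra X S \<and> G \<subseteq> S}"

definition is_basis_family ::
    "'i set \<Rightarrow> ('i \<Rightarrow> 'p \<Rightarrow> 'p \<Rightarrow> 'f::field) \<Rightarrow> ('p \<Rightarrow> 'p \<Rightarrow> 'f) set \<Rightarrow> bool" where
  "is_basis_family I b V \<longleftrightarrow>
     inj_on b I \<and> mat.independent (b ` I) \<and> mat.span (b ` I) = V"

definition XX :: "nat \<Rightarrow> (nat \<Rightarrow> 'u set) \<Rightarrow> (nat \<Rightarrow> 'u) set" where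
  "XX n U = (\<Pi>\<^sub>E a\<in>{1..n}. U a)"

definition EE :: "nat \<Rightarrow> (nat \<Rightarrow> nat) set" where
  "EE n = (\<Pi>\<^sub>E a\<in>{1..n}. {0, 1})"

definition supp :: "nat \<Rightarrow> (nat \<Rightarrow> nat) \<Rightarrow> nat set" where
  "supp n g = {a \<in> {1..n}. g a = 1}"

definition with_supp :: "nat \<Rightarrow> nat set \<Rightarrow> nat \<Rightarrow> nat" where
  "with_supp n V = (\<lambda>a\<in>{1..n}. if a \<in> V then 1 else 0)"

definition meet3 ::
    "nat \<Rightarrow> (nat \<Rightarrow> nat) \<Rightarrow> (nat \<Rightarrow> nat) \<Rightarrow> (nat \<Rightarrow> nat) \<Rightarrow> nat \<Rightarrow> nat" where
  "meet3 n g h i = with_supp n (supp n g \<inter> supp n h \<inter> supp n i)"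

definition circ :: "(nat \<Rightarrow> 'u set) \<Rightarrow> nat set \<Rightarrow> nat set" where
  "circ U V = {a \<in> V. card (U a) > 2}"

definition RR ::
    "nat \<Rightarrow> (nat \<Rightarrow> 'u set) \<Rightarrow> (nat \<Rightarrow> nat) \<Rightarrow> ((nat \<Rightarrow> 'u) \<times> (nat \<Rightarrow> 'u)) set" where
  "RR n U g = {(y, z). y \<in> XX n U \<and> z \<in> XX n U \<and> (\<forall>a\<in>{1..n}. y a \<noteq> z a \<longleftrightarrow> g a = 1)}"

definition valency :: "nat \<Rightarrow> (nat \<Rightarrow> 'u set) \<Rightarrow> (nat \<Rightarrow> nat) \<Rightarrow> nat" where
  "valency n U g = (\<Prod>a\<in>supp n g. card (U a) - 1)"

definition adj ::
    "nat \<Rightarrow> (nat \<Rightarrow> 'u set) \<Rightarrow> (nat \<Rightarrow> nat) \<Rightarrow> (nat \<Rightarrow> 'u) \<Rightarrow> (nat \<Rightarrow> 'u) \<Rightarrow> 'f::field" where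
  "adj n U g = (\<lambda>y z. of_bool ((y, z) \<in> RR n U g))"

definition dual_idem ::
    "nat \<Rightarrow> (nat \<Rightarrow> 'u set) \<Rightarrow> (nat \<Rightarrow> 'u) \<Rightarrow> (nat \<Rightarrow> nat) \<Rightarrow>
     (nat \<Rightarrow> 'u) \<Rightarrow> (nat \<Rightarrow> 'u) \<Rightarrow> 'f::field" where
  "dual_idem n U x g = (\<lambda>y z. of_bool (y = z \<and> (x, y) \<in> RR n U g))"

definition TT ::
    "nat \<Rightarrow> (nat \<Rightarrow> 'u set) \<Rightarrow> (nat \<Rightarrow> 'u) \<Rightarrow> ((nat \<Rightarrow> 'u) \<Rightarrow> (nat \<Rightarrow> 'u) \<Rightarrow> 'f::field) set" where
  "TT n U x = generated_subalgebra (XX n U) (adj n U ` EE n \<union> dual_idem n U x ` EE n)"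

definition PP ::
    "nat \<Rightarrow> (nat \<Rightarrow> 'u set) \<Rightarrow> ((nat \<Rightarrow> nat) \<times> (nat \<Rightarrow> nat) \<times> (nat \<Rightarrow> nat)) set" where
  "PP n U = {(a, b, c). a \<in> EE n \<and> b \<in> EE n \<and> c \<in> EE n \<and>
     sym_diff (supp n a) (supp n c) \<subseteq> supp n b \<and>
     supp n b \<subseteq> sym_diff (supp n a) (supp n c) \<union> circ U (supp n a \<inter> supp n c)}"

definition BB ::
    "nat \<Rightarrow> (nat \<Rightarrow> 'u set) \<Rightarrow> (nat \<Rightarrow> 'u) \<Rightarrow> (nat \<Rightarrow> nat) \<times> (nat \<Rightarrow> nat) \<times> (nat \<Rightarrow> nat) \<Rightarrow>
     (nat \<Rightarrow> 'u) \<Rightarrow> (nat \<Rightarrow> 'u) \<Rightarrow> 'f::field" where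
  "BB n U x = (\<lambda>(g, h, i).
     \<Sum>j | j \<in> EE n \<and> sym_diff (supp n g) (supp n i) \<subseteq> supp n j \<and> supp n j \<subseteq> supp n h.
       mat_mul (XX n U) (mat_mul (XX n U) (dual_idem n U x g) (adj n U j)) (dual_idem n U x i))"

definition bracket ::
    "nat \<Rightarrow> (nat \<Rightarrow> 'u set) \<Rightarrow> (nat \<Rightarrow> nat) \<Rightarrow> (nat \<Rightarrow> nat) \<Rightarrow> (nat \<Rightarrow> nat) \<Rightarrow>
     (nat \<Rightarrow> nat) \<Rightarrow> (nat \<Rightarrow> nat) \<Rightarrow> nat \<Rightarrow> nat" where
  "bracket n U g h i j k = with_supp n
     (sym_diff (supp n g) (supp n k) \<union>
      (circ U (supp n g \<inter> supp n k) - supp n i) \<union>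
      ((supp n h \<union> supp n j) \<inter> circ U (supp n g \<inter> supp n i \<inter> supp n k)))"

end

theory Submission
  imports Defs
begin

text \<open>
  For \<open>y, z\<close> in \<open>X\<close> let \<open>D y z\<close> be the set of coordinates in which they differ. The
  matrix \<open>B (g, h, i)\<close> is the indicator of \<open>D x y = S g\<close>, \<open>D x z = S i\<close>,
  \<open>D y z \<subseteq> S h\<close>, so an entry of a product of two of them counts the points \<open>w\<close> subject to
  conditions that decouple over the coordinates. A coordinate in \<open>S h \<inter> S i \<inter> S k\<close>
  contributes \<open>|U a| - 1\<close>, every other one contributes 1, except that a coordinate in
  \<open>S i\<close> outside \<open>S h \<union> S k\<close> forces \<open>y a = z a\<close>; hence the product is
  \<open>k \<cdot> B (g, [g, h, i, k, l], l)\<close> with \<open>k\<close> the valency. The \<open>B\<close> are related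
  to the matrices \<open>E* A E*\<close>, which are indicators of disjoint nonempty sets, by a
  unitriangular change of family; this gives independence, and the generators in the span.
\<close>

section \<open>Supports and difference sets\<close>

lemma sum_fun_apply2: "(\<Sum>a\<in>A. f a) y z = (\<Sum>a\<in>A. f a y z)"
  for f :: "'a \<Rightarrow> 'b \<Rightarrow> 'c \<Rightarrow> 'd::comm_monoid_add"
  by (induction A rule: infinite_finite_induct) auto

definition diff_set :: "nat \<Rightarrow> (nat \<Rightarrow> 'u) \<Rightarrow> (nat \<Rightarrow> 'u) \<Rightarrow> nat set" where
  "diff_set n y z = {a \<in> {1..n}. y a \<noteq> z a}"

lemma diff_set_subset: "diff_set n y z \<subseteq> {1..n}"
  by (auto simp: diff_set_def)

lemma supp_subset: "supp n g \<subseteq> {1..n}"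
  by (auto simp: supp_def)

lemma finite_supp [simp]: "finite (supp n g)"
  by (simp add: supp_def)

lemma supp_with_supp: "supp n (with_supp n V) = V \<inter> {1..n}"
  by (auto simp: supp_def with_supp_def)

lemma with_supp_in_EE [simp]: "with_supp n V \<in> EE n"
  by (auto simp: with_supp_def EE_def)

lemma finite_EE [simp]: "finite (EE n)"
  by (auto simp: EE_def intro!: finite_PiE)

lemma supp_inj:
  assumes "g \<in> EE n" "h \<in> EE n" "supp n g = supp n h"
  shows "g = h"
proof (rule PiE_ext[OF assms(1,2)[unfolded EE_def]])
  fix a assume a: "a \<in> {1..n}"
  then have "g a \<in> {0,1}" "h a \<in> {0,1}" using assms unfolding EE_def by (auto dest: PiE_mem)
  moreover have "g a = 1 \<longleftrightarrow> h a = 1" using assms(3) a by (auto simp: supp_def)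
  ultimately show "g a = h a" by auto
qed

lemma RR_iff: "(y, z) \<in> RR n U g \<longleftrightarrow> y \<in> XX n U \<and> z \<in> XX n U \<and> diff_set n y z = supp n g"
  unfolding RR_def diff_set_def supp_def mem_Collect_eq prod.case set_eq_iff by blast

text \<open>If exactly one of \<open>y\<close>, \<open>z\<close> agrees with \<open>x\<close> in a
  coordinate, they cannot agree with each other there. This is the origin of the lower bound in
  \<open>PP\<close>.\<close>

lemma sym_diff_subset_diff_set:
  "sym_diff (diff_set n x y) (diff_set n x z) \<subseteq> diff_set n y z"
  by (auto simp: diff_set_def)

section \<open>Points of \<open>X\<close> and the triples of supports they realise\<close>

locale terwilliger =
  fixes n :: nat and U :: "nat \<Rightarrow> 'u set" and x :: "nat \<Rightarrow> 'u"
  assumes finite_U: "\<And>a. a \<in> {1..n} \<Longrightarrow> finite (U a)"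
    and card_U: "\<And>a. a \<in> {1..n} \<Longrightarrow> card (U a) \<ge> 2"
    and x_in: "x \<in> XX n U"
begin

abbreviation "X \<equiv> XX n U"
abbreviation "S \<equiv> supp n"
abbreviation "D \<equiv> diff_set n"
abbreviation "P \<equiv> PP n U"

lemma finite_X [simp]: "finite X"
  by (auto simp: XX_def intro!: finite_PiE finite_U)

lemma finite_P [simp]: "finite P"
  by (rule finite_subset[of _ "EE n \<times> EE n \<times> EE n"]) (auto simp: PP_def)

lemma x_in_U: "a \<in> {1..n} \<Longrightarrow> x a \<in> U a"
  using x_in by (auto simp: XX_def)

lemma ex_other:
  assumes "a \<in> {1..n}" shows "\<exists>u\<in>U a. u \<noteq> x a"
proof (rule ccontr)
  assume "\<not> ?thesis"
  then have "U a \<subseteq> {x a}" by auto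
  then have "card (U a) \<le> 1" using card_mono[of "{x a}" "U a"] by simp
  with card_U[OF assms] show False by simp
qed

lemma ex_other2:
  assumes "card (U a) > 2" shows "\<exists>u\<in>U a. u \<noteq> x a \<and> u \<noteq> v"
proof (rule ccontr)
  assume "\<not> ?thesis"
  then have "U a \<subseteq> {x a, v}" by auto
  then have "card (U a) \<le> card {x a, v}" by (intro card_mono) auto
  also have "\<dots> \<le> 2" by (simp add: card_insert_if)
  finally show False using assms by simp
qed

text \<open>Two distinct values, both different from \<open>x a\<close>, would give
  \<open>U a\<close> at least three elements. This is why \<open>circ\<close> occurs: two points
  that both differ from \<open>x\<close> in a coordinate can differ from each other there only if
  \<open>card (U a) > 2\<close>.\<close>

lemma unique_other:
  assumes a: "a \<in> {1..n}" and "\<not> card (U a) > 2"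
    and "u \<in> U a" "v \<in> U a" "u \<noteq> x a" "v \<noteq> x a"
  shows "u = v"
proof (rule ccontr)
  assume "u \<noteq> v"
  then have "card {x a, u, v} = 3" using assms by auto
  moreover have "card {x a, u, v} \<le> card (U a)"
    using assms x_in_U[OF a] finite_U[OF a] by (intro card_mono) auto
  ultimately show False using assms(2) by simp
qed

text \<open>A coordinate in which \<open>x\<close>, \<open>y\<close>, \<open>z\<close> are pairwise
  distinct lies in \<open>circ\<close> by \<open>unique_other\<close>. Together with
  \<open>P_witness\<close> this identifies \<open>P\<close> as the set of triples realised by a pair
  of points, that is, those with nonzero \<open>CC\<close>.\<close>

lemma P_I:
  assumes "a \<in> EE n" "b \<in> EE n" "c \<in> EE n" "y \<in> X" "z \<in> X"
    and "D x y = S a" "D x z = S c" "D y z = S b"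
  shows "(a, b, c) \<in> P"
proof -
  have "S b \<subseteq> sym_diff (S a) (S c) \<union> circ U (S a \<inter> S c)"
  proof
    fix e assume e: "e \<in> S b"
    then have en: "e \<in> {1..n}" using supp_subset by blast
    have ne: "y e \<noteq> z e" using e assms(8) by (auto simp: diff_set_def)
    have U: "y e \<in> U e" "z e \<in> U e" using assms(4,5) en by (auto simp: XX_def)
    have sa: "e \<in> S a \<longleftrightarrow> x e \<noteq> y e" using assms(6) en by (auto simp: diff_set_def)
    have sc: "e \<in> S c \<longleftrightarrow> x e \<noteq> z e" using assms(7) en by (auto simp: diff_set_def)
    show "e \<in> sym_diff (S a) (S c) \<union> circ U (S a \<inter> S c)"
      using unique_other[OF en _ U] ne sa sc
      by (cases "card (U e) > 2") (auto simp: circ_def)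
  qed
  then show ?thesis
    using assms sym_diff_subset_diff_set[of n x y z] by (auto simp: PP_def)
qed

text \<open>The points are built coordinate by coordinate; a second value besides \<open>x e\<close>
  and \<open>o1 e\<close> is needed only in coordinates common to all three supports, and the upper
  bound in \<open>PP\<close> provides it.\<close>

lemma P_witness:
  assumes "(a, b, c) \<in> P"
  shows "\<exists>y\<in>X. \<exists>z\<in>X. D x y = S a \<and> D x z = S c \<and> D y z = S b"
proof -
  obtain o1 where o1: "\<And>e. e \<in> {1..n} \<Longrightarrow> o1 e \<in> U e \<and> o1 e \<noteq> x e"
    using ex_other by metis
  obtain o2 where o2: "\<And>e. card (U e) > 2 \<Longrightarrow> o2 e \<in> U e \<and> o2 e \<noteq> x e \<and> o2 e \<noteq> o1 e"
  proof -
    have "\<forall>e. \<exists>u. card (U e) > 2 \<longrightarrow> u \<in> U e \<and> u \<noteq> x e \<and> u \<noteq> o1 e"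
      using ex_other2 by blast
    then show ?thesis using that by metis
  qed
  define y where "y = (\<lambda>e\<in>{1..n}. if e \<in> S a then o1 e else x e)"
  \<comment> \<open>\<open>o2\<close> is used exactly where \<open>z\<close> has to avoid both
    \<open>x\<close> and \<open>y\<close>. Elsewhere in \<open>S c\<close> the value
    \<open>o1\<close> works: it equals \<open>y\<close> on \<open>S a - S b\<close> and differs from
    \<open>y\<close> outside \<open>S a\<close>, where \<open>y\<close> agrees with
    \<open>x\<close>.\<close>
  define z where "z = (\<lambda>e\<in>{1..n}. if e \<in> S c then
      (if e \<in> S a \<and> e \<in> S b then o2 e else o1 e) else x e)"
  have p: "sym_diff (S a) (S c) \<subseteq> S b" "S b \<subseteq> sym_diff (S a) (S c) \<union> circ U (S a \<inter> S c)"
    using assms by (auto simp: PP_def)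
  have big: "card (U e) > 2" if "e \<in> S a" "e \<in> S b" "e \<in> S c" for e
    using that p(2) by (auto simp: circ_def)
  have "y \<in> X" using o1 x_in_U by (auto simp: y_def XX_def)
  moreover have "z \<in> X" using o1 o2 big x_in_U by (auto simp: z_def XX_def)
  moreover have "e \<in> D x y \<longleftrightarrow> e \<in> S a" for e
    using o1[of e] supp_subset[of n a] by (auto simp: y_def diff_set_def)
  moreover have "e \<in> D x z \<longleftrightarrow> e \<in> S c" for e
    using o1[of e] o2[of e] big[of e] supp_subset[of n c] by (auto simp: z_def diff_set_def)
  moreover have "e \<in> D y z \<longleftrightarrow> e \<in> S b" for e
  proof (cases "e \<in> {1..n}")
    case True
    then show ?thesis
      using o1[OF True] o2[of e] big[of e] p(1) subsetD[OF p(2), of e]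
      by (auto simp: y_def z_def diff_set_def circ_def)
  next
    case False
    then show ?thesis using supp_subset[of n b] by (auto simp: diff_set_def)
  qed
  ultimately show ?thesis by blast
qed

section \<open>Entries of the matrices\<close>

lemma dual_idem_entry:
  "dual_idem n U x g y z = of_bool (y = z \<and> y \<in> X \<and> D x y = S g)"
  using x_in by (auto simp: dual_idem_def RR_iff)

lemma adj_entry: "adj n U g y z = of_bool (y \<in> X \<and> z \<in> X \<and> D y z = S g)"
  by (simp add: adj_def RR_iff)

definition CC :: "(nat \<Rightarrow> nat) \<Rightarrow> (nat \<Rightarrow> nat) \<Rightarrow> (nat \<Rightarrow> nat) \<Rightarrow>
    (nat \<Rightarrow> 'u) \<Rightarrow> (nat \<Rightarrow> 'u) \<Rightarrow> 'f::field" where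
  "CC g j i = mat_mul X (mat_mul X (dual_idem n U x g) (adj n U j)) (dual_idem n U x i)"

lemma CC_entry:
  "(CC g j i :: _ \<Rightarrow> _ \<Rightarrow> 'f::field) y z =
     of_bool (y \<in> X \<and> z \<in> X \<and> D x y = S g \<and> D x z = S i \<and> D y z = S j)"
proof -
  have "mat_mul X (dual_idem n U x g) (adj n U j) y w =
      (of_bool (y \<in> X \<and> w \<in> X \<and> D x y = S g \<and> D y w = S j) :: 'f)" for w
  proof -
    have "mat_mul X (dual_idem n U x g) (adj n U j) y w =
        (\<Sum>v\<in>X. if v = y then of_bool (y \<in> X \<and> w \<in> X \<and> D x y = S g \<and> D y w = S j) else (0::'f))"
      unfolding mat_mul_def by (intro sum.cong) (auto simp: dual_idem_entry adj_entry)
    then show ?thesis by auto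
  qed
  then have "(CC g j i :: _ \<Rightarrow> _ \<Rightarrow> 'f) y z = (\<Sum>w\<in>X. if w = z then
      of_bool (y \<in> X \<and> z \<in> X \<and> D x y = S g \<and> D x z = S i \<and> D y z = S j) else 0)"
    unfolding CC_def mat_mul_def[of X "mat_mul _ _ _"]
    by (intro sum.cong) (auto simp: dual_idem_entry)
  then show ?thesis by auto
qed

text \<open>A pair \<open>(y, z)\<close> is seen only by the summand whose index has support
  \<open>D y z\<close>. The lower bound on that support is automatic by
  \<open>sym_diff_subset_diff_set\<close>, so only the upper bound \<open>S h\<close>
  survives.\<close>

lemma BB_entry:
  "(BB n U x (g, h, i) :: _ \<Rightarrow> _ \<Rightarrow> 'f::field) y z =
     of_bool (y \<in> X \<and> z \<in> X \<and> D x y = S g \<and> D x z = S i \<and> D y z \<subseteq> S h)"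
proof -
  let ?J = "{j \<in> EE n. sym_diff (S g) (S i) \<subseteq> S j \<and> S j \<subseteq> S h}"
  let ?c = "y \<in> X \<and> z \<in> X \<and> D x y = S g \<and> D x z = S i"
  let ?d = "with_supp n (D y z)"
  have d: "S ?d = D y z" using diff_set_subset[of n y z] by (auto simp: supp_with_supp)
  have "(BB n U x (g, h, i) :: _ \<Rightarrow> _ \<Rightarrow> 'f) y z = (\<Sum>j\<in>?J. CC g j i y z)"
    by (simp add: BB_def sum_fun_apply2 CC_def)
  also have "\<dots> = (\<Sum>j\<in>?J. if j = ?d then of_bool ?c else 0)"
    using d by (intro sum.cong) (auto simp: CC_entry dest: supp_inj[of _ n ?d])
  also have "\<dots> = of_bool (?c \<and> ?d \<in> ?J)" by (auto simp: if_distrib)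
  also have "?c \<and> ?d \<in> ?J \<longleftrightarrow> ?c \<and> D y z \<subseteq> S h"
    using d sym_diff_subset_diff_set[of n x y z] by auto
  finally show ?thesis by (simp add: conj_assoc)
qed

section \<open>Linear independence of the family \<open>BB\<close>\<close>

text \<open>The entry at a witness pair of one triple is 1; read in the other matrix, it forces
  equal outer indices and one inclusion of the middle supports. Exchanging the roles gives the other
  inclusion.\<close>

lemma BB_inj: "inj_on (BB n U x :: _ \<Rightarrow> _ \<Rightarrow> _ \<Rightarrow> 'f::field) P"
proof -
  have key: "g = g' \<and> i = i' \<and> S h \<subseteq> S h'"
    if p: "(g, h, i) \<in> P" "(g', h', i') \<in> P"
      and eq: "(BB n U x (g, h, i) :: _ \<Rightarrow> _ \<Rightarrow> 'f) = BB n U x (g', h', i')" for g h i g' h' i'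
  proof -
    obtain y z where w: "y \<in> X" "z \<in> X" "D x y = S g" "D x z = S i" "D y z = S h"
      using P_witness[OF p(1)] by blast
    have "(BB n U x (g, h, i) :: _ \<Rightarrow> _ \<Rightarrow> 'f) y z = BB n U x (g', h', i') y z" using eq by simp
    then have "S g = S g' \<and> S i = S i' \<and> S h \<subseteq> S h'" using w by (simp add: BB_entry split: if_splits)
    then show ?thesis using p by (auto simp: PP_def intro: supp_inj)
  qed
  show ?thesis
  proof (rule inj_onI)
    fix p p' assume p: "p \<in> P" "p' \<in> P" "(BB n U x p :: _ \<Rightarrow> _ \<Rightarrow> 'f) = BB n U x p'"
    obtain g h i g' h' i' where pp: "p = (g, h, i)" "p' = (g', h', i')" by (cases p, cases p')
    note * = p[unfolded pp]
    have "S h = S h'" using key[OF *] key[OF *(2,1) *(3)[symmetric]] by blast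
    then have "h = h'" using * by (auto simp: PP_def intro: supp_inj)
    then show "p = p'" using key[OF *] by (simp add: pp)
  qed
qed

text \<open>The entry at a witness pair for \<open>(g, h, i)\<close> involves only the coefficients
  of \<open>(g, h', i)\<close> with \<open>S h \<subseteq> S h'\<close>. Induction from large
  supports to small ones therefore isolates \<open>c (g, h, i)\<close>.\<close>

lemma BB_combination_zero:
  fixes c :: "(nat \<Rightarrow> nat) \<times> (nat \<Rightarrow> nat) \<times> (nat \<Rightarrow> nat) \<Rightarrow> 'f::field"
  assumes zero: "(\<Sum>p\<in>P. mat_scale (c p) (BB n U x p)) = 0"
  shows "(g, h, i) \<in> P \<Longrightarrow> c (g, h, i) = 0"
proof (induction "n - card (S h)" arbitrary: h rule: less_induct)
  case less
  obtain y z where w: "y \<in> X" "z \<in> X" "D x y = S g" "D x z = S i" "D y z = S h"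
    using P_witness[OF less.prems] by blast
  have "0 = (\<Sum>p\<in>P. mat_scale (c p) (BB n U x p)) y z" using zero by simp
  also have "\<dots> = (\<Sum>p\<in>P. c p * BB n U x p y z)" by (simp add: sum_fun_apply2 mat_scale_def)
  also have "\<dots> = (\<Sum>p\<in>P. if p = (g, h, i) then c (g, h, i) else 0)"
  proof (intro sum.cong refl)
    fix p assume p: "p \<in> P"
    obtain g' h' i' where p': "p = (g', h', i')" by (cases p)
    show "c p * BB n U x p y z = (if p = (g, h, i) then c (g, h, i) else 0)"
    proof (cases "S g = S g' \<and> S i = S i' \<and> S h \<subseteq> S h'")
      case True
      then have [simp]: "g' = g" "i' = i"
        using p less.prems unfolding p' by (auto simp: PP_def intro: supp_inj)
      show ?thesis
      proof (cases "S h' = S h")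
        case True
        then have "h' = h" using p less.prems unfolding p' by (auto simp: PP_def intro: supp_inj)
        then show ?thesis using w by (simp add: p' BB_entry)
      next
        case False
        with True have "S h \<subset> S h'" by blast
        then have "card (S h) < card (S h')" by (simp add: psubset_card_mono)
        \<comment> \<open>The measure uses truncated subtraction, so this bound is what makes it
          drop strictly.\<close>
        moreover have "card (S h') \<le> n" using card_mono[OF _ supp_subset[of n h']] by simp
        ultimately have "c (g, h', i) = 0" using less.hyps[of h'] p unfolding p' by simp
        then show ?thesis using False by (auto simp: p')
      qed
    next
      case False
      then show ?thesis using w by (auto simp: p' BB_entry)
    qed
  qed
  also have "\<dots> = c (g, h, i)" using less.prems by simp
  finally show ?case by simp
qed

lemma BB_independent: "mat.independent (BB n U x ` P :: (_ \<Rightarrow> _ \<Rightarrow> 'f::field) set)"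
proof (rule mat.independent_if_scalars_zero)
  fix f :: "(_ \<Rightarrow> _ \<Rightarrow> 'f) \<Rightarrow> 'f" and M :: "_ \<Rightarrow> _ \<Rightarrow> 'f"
  assume 0: "(\<Sum>M\<in>BB n U x ` P. mat_scale (f M) M) = 0" and M: "M \<in> BB n U x ` P"
  have "(\<Sum>p\<in>P. mat_scale (f (BB n U x p)) (BB n U x p)) = 0"
    using 0 by (simp add: sum.reindex[OF BB_inj] o_def)
  from BB_combination_zero[OF this] M show "f M = 0" by auto
qed simp

section \<open>The product formula\<close>

text \<open>Apart from the symmetric difference, both pieces of the bracket lie in
  \<open>circ U (S g \<inter> S l)\<close>.\<close>

lemma bracket_in_P:
  assumes "(g, h, i) \<in> P" "(j, k, l) \<in> P"
  shows "(g, bracket n U g h i k l, l) \<in> P"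
  using assms supp_subset[of n g] supp_subset[of n l]
  by (auto simp: PP_def bracket_def supp_with_supp circ_def)

text \<open>The admissible \<open>w\<close> form a product of sets \<open>W a\<close>, so their
  number is a product over the coordinates. This number is the entry of the matrix product at
  \<open>(y, z)\<close>, before it is mapped to the field.\<close>

lemma path_count:
  assumes gp: "(g, h, i) \<in> P" and kp: "(i, k, l) \<in> P"
    and y: "y \<in> X" "D x y = S g" and z: "z \<in> X" "D x z = S l"
  shows "card {w \<in> X. D x w = S i \<and> D y w \<subseteq> S h \<and> D w z \<subseteq> S k} =
    valency n U (meet3 n h i k) * of_bool (D y z \<subseteq> S (bracket n U g h i k l))"
proof -
  define W where "W a = {u \<in> U a. (x a \<noteq> u \<longleftrightarrow> a \<in> S i) \<and> (a \<notin> S h \<longrightarrow> u = y a) \<and>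
      (a \<notin> S k \<longrightarrow> u = z a)}" for a
  \<comment> \<open>In these coordinates \<open>w\<close> must equal both \<open>y\<close> and
    \<open>z\<close>, so they are the only ones that can leave no choice for
    \<open>w\<close>.\<close>
  define B where "B = S i - S h - S k"
  have gi: "sym_diff (S g) (S i) \<subseteq> S h" and il: "sym_diff (S i) (S l) \<subseteq> S k"
    using gp kp by (auto simp: PP_def)
  have yU: "y a \<in> U a" and zU: "z a \<in> U a" if "a \<in> {1..n}" for a
    using y z that by (auto simp: XX_def)
  have xy: "x a \<noteq> y a \<longleftrightarrow> a \<in> S g" and xz: "x a \<noteq> z a \<longleftrightarrow> a \<in> S l" if "a \<in> {1..n}" for a
    using y(2) z(2) that by (auto simp: diff_set_def)
  have "w \<in> X \<and> D x w = S i \<and> D y w \<subseteq> S h \<and> D w z \<subseteq> S k \<longleftrightarrow> w \<in> (\<Pi>\<^sub>E a\<in>{1..n}. W a)" for w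
  proof -
    have "w \<in> X \<longleftrightarrow> w \<in> extensional {1..n} \<and> (\<forall>a\<in>{1..n}. w a \<in> U a)"
      by (auto simp: XX_def PiE_iff)
    moreover have "D x w = S i \<longleftrightarrow> (\<forall>a\<in>{1..n}. x a \<noteq> w a \<longleftrightarrow> a \<in> S i)"
      using supp_subset[of n i] by (auto simp: diff_set_def)
    moreover have "D y w \<subseteq> S h \<longleftrightarrow> (\<forall>a\<in>{1..n}. a \<notin> S h \<longrightarrow> w a = y a)"
      by (auto simp: diff_set_def)
    moreover have "D w z \<subseteq> S k \<longleftrightarrow> (\<forall>a\<in>{1..n}. a \<notin> S k \<longrightarrow> w a = z a)"
      by (auto simp: diff_set_def)
    ultimately show ?thesis by (auto simp: PiE_iff W_def)
  qed
  then have "card {w \<in> X. D x w = S i \<and> D y w \<subseteq> S h \<and> D w z \<subseteq> S k} = (\<Prod>a\<in>{1..n}. card (W a))"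
    by (simp add: card_PiE)
  also have "\<dots> = (\<Prod>a\<in>{1..n}. (if a \<in> S h \<inter> S i \<inter> S k then card (U a) - 1 else 1) *
      of_bool (a \<in> B \<longrightarrow> y a = z a))"
  proof (intro prod.cong refl)
    fix a assume a: "a \<in> {1..n}"
    consider "a \<notin> S i" | "a \<in> S h" "a \<in> S i" "a \<in> S k" | "a \<in> S i" "a \<notin> S h" "a \<in> S k"
      | "a \<in> S i" "a \<in> S h" "a \<notin> S k" | "a \<in> S i" "a \<notin> S h" "a \<notin> S k" "y a = z a"
      | "a \<in> S i" "a \<notin> S h" "a \<notin> S k" "y a \<noteq> z a"
      by blast
    then show "card (W a) = (if a \<in> S h \<inter> S i \<inter> S k then card (U a) - 1 else 1) *
      of_bool (a \<in> B \<longrightarrow> y a = z a)"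
    proof cases
      case 1
      \<comment> \<open>Outside \<open>S i\<close> the value \<open>x a\<close> is forced. It meets
        the other two conditions: \<open>a \<notin> S h\<close> gives \<open>a \<notin> S g\<close>,
        hence \<open>y a = x a\<close>, and likewise for \<open>S k\<close> and
        \<open>z\<close>.\<close>
      then have "W a = {x a}"
        using gi il xy[OF a] xz[OF a] x_in_U[OF a] by (auto simp: W_def)
      with 1 show ?thesis by (simp add: B_def)
    next
      case 2
      then have "W a = U a - {x a}" by (auto simp: W_def)
      with 2 show ?thesis using x_in_U[OF a] finite_U[OF a] by (simp add: B_def)
    next
      case 3
      \<comment> \<open>Here \<open>gi\<close> puts \<open>a\<close> into \<open>S g\<close>, so the
        forced value \<open>y a\<close> does differ from \<open>x a\<close>.\<close>
      then have "W a = {y a}" using gi xy[OF a] yU[OF a] by (auto simp: W_def)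
      with 3 show ?thesis by (simp add: B_def)
    next
      case 4
      then have "W a = {z a}" using il xz[OF a] zU[OF a] by (auto simp: W_def)
      with 4 show ?thesis by (simp add: B_def)
    next
      case 5
      then have "W a = {y a}" using gi xy[OF a] yU[OF a] by (auto simp: W_def)
      with 5 show ?thesis by (simp add: B_def)
    next
      case 6
      then have "W a = {}" by (auto simp: W_def)
      with 6 show ?thesis by (simp add: B_def)
    qed
  qed
  also have "\<dots> = (\<Prod>a\<in>{1..n}. if a \<in> S h \<inter> S i \<inter> S k then card (U a) - 1 else 1) *
      (\<Prod>a\<in>{1..n}. of_bool (a \<in> B \<longrightarrow> y a = z a))"
    by (rule prod.distrib)
  also have "(\<Prod>a\<in>{1..n}. if a \<in> S h \<inter> S i \<inter> S k then card (U a) - 1 else 1) =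
      valency n U (meet3 n h i k)"
    using prod.inter_restrict[of "{1..n}" "\<lambda>a. card (U a) - 1" "S h \<inter> S i \<inter> S k"]
    by (simp add: valency_def meet3_def supp_with_supp Int_commute)
  also have "(\<Prod>a\<in>{1..n}. of_bool (a \<in> B \<longrightarrow> y a = z a)) =
      (of_bool (\<forall>a\<in>{1..n}. a \<in> B \<longrightarrow> y a = z a) :: nat)"
    by (auto intro!: prod.neutral)
  \<comment> \<open>The bracket need not be the complement of \<open>B\<close>, but the two
    conditions agree wherever \<open>y\<close> and \<open>z\<close> differ. Such a coordinate is in
    the symmetric difference, hence in the bracket and not in \<open>B\<close>, or in
    \<open>circ U (S g \<inter> S l)\<close>; there, missing the bracket means lying in
    \<open>S i\<close> but in neither \<open>S h\<close> nor \<open>S k\<close>.\<close>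
  also have "(\<forall>a\<in>{1..n}. a \<in> B \<longrightarrow> y a = z a) \<longleftrightarrow> D y z \<subseteq> S (bracket n U g h i k l)"
  proof -
    have "(a \<in> B \<longrightarrow> y a = z a) \<longleftrightarrow> (y a \<noteq> z a \<longrightarrow> a \<in> S (bracket n U g h i k l))"
      if a: "a \<in> {1..n}" for a
    proof -
      have "a \<in> B \<Longrightarrow> a \<in> S g \<inter> S l" using gi il by (auto simp: B_def)
      then show ?thesis
        using xy[OF a] xz[OF a] unique_other[OF a _ yU[OF a] zU[OF a]] a
        unfolding bracket_def supp_with_supp circ_def B_def
        by (cases "card (U a) > 2") auto
    qed
    then show ?thesis by (auto simp: diff_set_def)
  qed
  finally show ?thesis .
qed

text \<open>A nonzero term of the entry sum needs \<open>D x w\<close> to equal both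
  \<open>S i\<close> and \<open>S j\<close>, which gives the factor for \<open>i = j\<close>. What
  remains is the number of points in \<open>path_count\<close>.\<close>

lemma BB_mul:
  assumes gp: "(g, h, i) \<in> P" and kp: "(j, k, l) \<in> P"
  shows "mat_mul X (BB n U x (g, h, i)) (BB n U x (j, k, l)) =
    mat_scale (of_bool (i = j) * of_nat (valency n U (meet3 n h i k)))
      (BB n U x (g, bracket n U g h i k l, l) :: _ \<Rightarrow> _ \<Rightarrow> 'f::field)"
proof (intro ext)
  fix y z
  let ?c = "y \<in> X \<and> z \<in> X \<and> D x y = S g \<and> D x z = S l"
  let ?W = "{w \<in> X. D x w = S i \<and> D y w \<subseteq> S h \<and> D w z \<subseteq> S k}"
  have ij: "S i = S j \<longleftrightarrow> i = j" using gp kp by (auto simp: PP_def intro: supp_inj)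
  have "mat_mul X (BB n U x (g, h, i)) (BB n U x (j, k, l)) y z =
      (\<Sum>w\<in>X. of_bool (?c \<and> i = j) * (of_bool (w \<in> ?W) :: 'f))"
    unfolding mat_mul_def using ij by (intro sum.cong) (auto simp: BB_entry)
  also have "\<dots> = of_bool (?c \<and> i = j) * (\<Sum>w\<in>X. of_bool (w \<in> ?W))"
    by (simp add: sum_distrib_left)
  also have "(\<Sum>w\<in>X. of_bool (w \<in> ?W)) = (of_nat (card ?W) :: 'f)"
    by (simp add: sum.If_cases of_bool_def Collect_conj_eq Int_assoc[symmetric])
  also have "of_bool (?c \<and> i = j) * (of_nat (card ?W) :: 'f) = of_bool (?c \<and> i = j) *
      of_nat (valency n U (meet3 n h i k) * of_bool (D y z \<subseteq> S (bracket n U g h i k l)))"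
    using path_count[OF gp, of k l y z] kp by auto
  also have "\<dots> = mat_scale (of_bool (i = j) * of_nat (valency n U (meet3 n h i k)))
      (BB n U x (g, bracket n U g h i k l, l)) y z"
    by (simp add: mat_scale_def BB_entry)
  finally show "mat_mul X (BB n U x (g, h, i)) (BB n U x (j, k, l)) y z =
    mat_scale (of_bool (i = j) * of_nat (valency n U (meet3 n h i k)))
      (BB n U x (g, bracket n U g h i k l, l) :: _ \<Rightarrow> _ \<Rightarrow> 'f) y z" .
qed

section \<open>The span of the family is the algebra \<open>TT\<close>\<close>

abbreviation BBspan :: "((nat \<Rightarrow> 'u) \<Rightarrow> (nat \<Rightarrow> 'u) \<Rightarrow> 'f::field) set" where
  "BBspan \<equiv> mat.span (BB n U x ` P)"

lemma mat_mul_bilinear: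
  "mat_mul X (M + M') N = mat_mul X M N + mat_mul X M' N"
  "mat_mul X M (N + N') = mat_mul X M N + mat_mul X M N'"
  "mat_mul X (mat_scale c M) N = mat_scale c (mat_mul X M N)"
  "mat_mul X M (mat_scale c N) = mat_scale c (mat_mul X M N)"
  "mat_mul X 0 N = 0" "mat_mul X M 0 = 0"
  by (auto simp: mat_mul_def mat_scale_def fun_eq_iff algebra_simps sum.distrib sum_distrib_left)

text \<open>Bilinearity reduces this to two members of the family, whose product is a multiple of a
  third by \<open>BB_mul\<close>.\<close>

lemma BBspan_mul:
  fixes M N :: "(nat \<Rightarrow> 'u) \<Rightarrow> (nat \<Rightarrow> 'u) \<Rightarrow> 'f::field"
  assumes "M \<in> BBspan" "N \<in> BBspan"
  shows "mat_mul X M N \<in> BBspan"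
  using assms(1)
proof (induction rule: mat.span_induct_alt)
  case base
  show ?case by (subst mat_mul_bilinear(5)) (rule mat.span_zero)
next
  case (step c M1 M2)
  then obtain g h i where M1: "M1 = BB n U x (g, h, i)" "(g, h, i) \<in> P" by auto
  have "mat_mul X M1 N \<in> BBspan" using assms(2)
  proof (induction rule: mat.span_induct_alt)
    case base
    show ?case by (subst mat_mul_bilinear(6)) (rule mat.span_zero)
  next
    case (step d N1 N2)
    then obtain j k l where N1: "N1 = BB n U x (j, k, l)" "(j, k, l) \<in> P" by auto
    have "mat_mul X M1 N1 \<in> BBspan"
      using bracket_in_P[OF M1(2) N1(2)] unfolding M1(1) N1(1) BB_mul[OF M1(2) N1(2)]
      by (intro mat.span_scale mat.span_base) blast
    then show ?case
      using step by (simp only: mat_mul_bilinear mat.span_add mat.span_scale)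
  qed
  then show ?case
    using step by (simp only: mat_mul_bilinear mat.span_add mat.span_scale)
qed

text \<open>Inverts the unitriangular relation: for a triple in \<open>P\<close>, \<open>BB\<close>
  is \<open>CC g j i\<close> plus matrices \<open>CC g j' i\<close> with strictly smaller
  \<open>S j'\<close>. For all other triples \<open>CC\<close> vanishes.\<close>

lemma CC_in_BBspan:
  "g \<in> EE n \<Longrightarrow> j \<in> EE n \<Longrightarrow> i \<in> EE n \<Longrightarrow> (CC g j i :: _ \<Rightarrow> _ \<Rightarrow> 'f::field) \<in> BBspan"
proof (induction "card (S j)" arbitrary: j rule: less_induct)
  case less
  show ?case
  proof (cases "(g, j, i) \<in> P")
    case True
    let ?J = "{j' \<in> EE n. sym_diff (S g) (S i) \<subseteq> S j' \<and> S j' \<subseteq> S j}"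
    have J: "finite ?J" "j \<in> ?J" using True less.prems by (auto simp: PP_def)
    have "BB n U x (g, j, i) = (\<Sum>j'\<in>?J. CC g j' i :: _ \<Rightarrow> _ \<Rightarrow> 'f)"
      by (simp add: BB_def CC_def)
    then have eq: "(CC g j i :: _ \<Rightarrow> _ \<Rightarrow> 'f) = BB n U x (g, j, i) - (\<Sum>j'\<in>?J - {j}. CC g j' i)"
      using sum.remove[OF J, of "\<lambda>j'. CC g j' i :: _ \<Rightarrow> _ \<Rightarrow> 'f"] by (simp add: algebra_simps)
    have CC: "(CC g j' i :: _ \<Rightarrow> _ \<Rightarrow> 'f) \<in> BBspan" if "j' \<in> ?J - {j}" for j'
    proof -
      have "S j' \<subset> S j" using that less.prems supp_inj[of j' n j] by auto
      then have "card (S j') < card (S j)" by (simp add: psubset_card_mono)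
      then show ?thesis using less.hyps[of j'] less.prems that by auto
    qed
    have "(\<Sum>j'\<in>?J - {j}. CC g j' i :: _ \<Rightarrow> _ \<Rightarrow> 'f) \<in> BBspan"
      by (rule mat.span_sum) (rule CC)
    moreover have "(BB n U x (g, j, i) :: _ \<Rightarrow> _ \<Rightarrow> 'f) \<in> BBspan"
      using True by (blast intro: mat.span_base)
    ultimately show ?thesis by (subst eq) (rule mat.span_diff)
  next
    case False
    have "(CC g j i :: _ \<Rightarrow> _ \<Rightarrow> 'f) y z = 0" for y z
      using False P_I[of g j i y z] less.prems by (auto simp: CC_entry)
    then have "(CC g j i :: _ \<Rightarrow> _ \<Rightarrow> 'f) = 0" by (simp add: fun_eq_iff)
    then show ?thesis by (simp add: mat.span_zero)
  qed
qed

text \<open>With empty middle support the condition \<open>D y z \<subseteq> {}\<close> says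
  \<open>y = z\<close>, so the idempotent is itself a member of the family.\<close>

lemma dual_idem_in_BBspan:
  assumes "g \<in> EE n"
  shows "(dual_idem n U x g :: _ \<Rightarrow> _ \<Rightarrow> 'f::field) \<in> BBspan"
proof -
  have "y = z" if "y \<in> X" "z \<in> X" "D y z = {}" for y z
    using that by (intro PiE_ext[of y "{1..n}" U z]) (auto simp: XX_def diff_set_def)
  moreover have "D y y = {}" for y by (simp add: diff_set_def)
  ultimately have "(dual_idem n U x g :: _ \<Rightarrow> _ \<Rightarrow> 'f) = BB n U x (g, with_supp n {}, g)"
    by (intro ext) (auto simp: dual_idem_entry BB_entry supp_with_supp)
  moreover have "(g, with_supp n {}, g) \<in> P"
    using assms by (auto simp: PP_def supp_with_supp)
  ultimately show ?thesis by (auto intro: mat.span_base)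
qed

text \<open>The relations partition \<open>X \<times> X\<close>: exactly one index has support
  \<open>D y z\<close>.\<close>

lemma sum_EE_indicator:
  "(\<Sum>g\<in>EE n. of_bool (D y z = S g) :: 'f::field) = 1"
proof -
  let ?d = "with_supp n (D y z)"
  have d: "S ?d = D y z" using diff_set_subset[of n y z] by (auto simp: supp_with_supp)
  have "(\<Sum>g\<in>EE n. of_bool (D y z = S g) :: 'f) = (\<Sum>g\<in>EE n. if g = ?d then 1 else 0)"
    using d by (intro sum.cong) (auto dest: supp_inj[of _ n ?d])
  then show ?thesis by simp
qed

lemma mat_one_in_BBspan: "(mat_one X :: _ \<Rightarrow> _ \<Rightarrow> 'f::field) \<in> BBspan"
proof -
  have "(\<Sum>g\<in>EE n. dual_idem n U x g :: _ \<Rightarrow> _ \<Rightarrow> 'f) y z = mat_one X y z" for y z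
  proof -
    have "(\<Sum>g\<in>EE n. dual_idem n U x g :: _ \<Rightarrow> _ \<Rightarrow> 'f) y z =
        (\<Sum>g\<in>EE n. of_bool (y = z \<and> y \<in> X) * of_bool (D x y = S g))"
      unfolding sum_fun_apply2 by (intro sum.cong) (auto simp: dual_idem_entry)
    also have "\<dots> = of_bool (y = z \<and> y \<in> X)"
      by (simp add: sum_distrib_left[symmetric] sum_EE_indicator)
    finally show ?thesis by (auto simp: mat_one_def)
  qed
  then have "(mat_one X :: _ \<Rightarrow> _ \<Rightarrow> 'f) = (\<Sum>g\<in>EE n. dual_idem n U x g)"
    by (simp add: fun_eq_iff)
  then show ?thesis by (simp add: mat.span_sum dual_idem_in_BBspan)
qed

text \<open>The dual idempotents sum to the identity; inserting this on both sides of the adjacency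
  matrix cuts it into the blocks \<open>CC g j i\<close>.\<close>

lemma adj_in_BBspan:
  assumes "j \<in> EE n"
  shows "(adj n U j :: _ \<Rightarrow> _ \<Rightarrow> 'f::field) \<in> BBspan"
proof -
  have "(\<Sum>g\<in>EE n. \<Sum>i\<in>EE n. CC g j i :: _ \<Rightarrow> _ \<Rightarrow> 'f) y z = adj n U j y z" for y z
  proof -
    have "(\<Sum>g\<in>EE n. \<Sum>i\<in>EE n. CC g j i :: _ \<Rightarrow> _ \<Rightarrow> 'f) y z =
        (\<Sum>g\<in>EE n. \<Sum>i\<in>EE n. adj n U j y z * (of_bool (D x y = S g) * of_bool (D x z = S i)))"
      unfolding sum_fun_apply2 by (intro sum.cong) (auto simp: CC_entry adj_entry)
    also have "\<dots> = adj n U j y z"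
      by (simp add: sum_distrib_left[symmetric] sum_EE_indicator)
    finally show ?thesis .
  qed
  then have "(adj n U j :: _ \<Rightarrow> _ \<Rightarrow> 'f) = (\<Sum>g\<in>EE n. \<Sum>i\<in>EE n. CC g j i)"
    by (simp add: fun_eq_iff)
  then show ?thesis using assms by (simp add: mat.span_sum CC_in_BBspan)
qed

lemma BBspan_subalgebra: "mat_subalgebra X (BBspan :: (_ \<Rightarrow> _ \<Rightarrow> 'f::field) set)"
proof -
  \<comment> \<open>The ambient vector space consists of all functions of two arguments, so
    vanishing outside \<open>X \<times> X\<close> has to be checked for the span.\<close>
  have "mat.subspace (mat_carrier X :: (_ \<Rightarrow> _ \<Rightarrow> 'f) set)"
    unfolding mat.subspace_def by (auto simp: mat_carrier_def mat_scale_def) (metis add_0_left)+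
  moreover have "BB n U x ` P \<subseteq> (mat_carrier X :: (_ \<Rightarrow> _ \<Rightarrow> 'f) set)"
    by (auto simp: mat_carrier_def BB_entry)
  ultimately have "BBspan \<subseteq> (mat_carrier X :: (_ \<Rightarrow> _ \<Rightarrow> 'f) set)"
    by (intro mat.span_minimal)
  then show ?thesis
    by (simp add: mat_subalgebra_def mat.subspace_span mat_one_in_BBspan BBspan_mul)
qed

text \<open>The span is a subalgebra containing the generators, and each \<open>BB\<close> is a sum
  of products of generators.\<close>

lemma BBspan_eq_TT: "(BBspan :: (_ \<Rightarrow> _ \<Rightarrow> 'f::field) set) = TT n U x"
proof
  show "(TT n U x :: (_ \<Rightarrow> _ \<Rightarrow> 'f) set) \<subseteq> BBspan"
    unfolding TT_def generated_subalgebra_def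
    using BBspan_subalgebra by (intro Inter_lower) (auto simp: adj_in_BBspan dual_idem_in_BBspan)
  show "(BBspan :: (_ \<Rightarrow> _ \<Rightarrow> 'f) set) \<subseteq> TT n U x"
    unfolding TT_def generated_subalgebra_def
  proof (rule Inter_greatest)
    fix T :: "(_ \<Rightarrow> _ \<Rightarrow> 'f) set"
    assume "T \<in> {S. mat_subalgebra X S \<and> adj n U ` EE n \<union> dual_idem n U x ` EE n \<subseteq> S}"
    then have T: "mat.subspace T" "\<And>M N. M \<in> T \<Longrightarrow> N \<in> T \<Longrightarrow> mat_mul X M N \<in> T"
      "\<And>g. g \<in> EE n \<Longrightarrow> adj n U g \<in> T" "\<And>g. g \<in> EE n \<Longrightarrow> dual_idem n U x g \<in> T"
      by (auto simp: mat_subalgebra_def)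
    have "BB n U x p \<in> T" if "p \<in> P" for p
      using that by (auto simp: BB_def PP_def intro!: mat.subspace_sum T)
    then show "BBspan \<subseteq> T" using T(1) by (intro mat.span_minimal) auto
  qed
qed

end

theorem theorem3p23:
  fixes n :: nat and U :: "nat \<Rightarrow> 'u set" and x :: "nat \<Rightarrow> 'u"
    and g h i j k l m q r :: "nat \<Rightarrow> nat"
  assumes "n \<ge> 1"
    and "\<And>a. a \<in> {1..n} \<Longrightarrow> finite (U a)"
    and "\<And>a. a \<in> {1..n} \<Longrightarrow> card (U a) \<ge> 2"
    and "x \<in> XX n U"
    and "(g, h, i) \<in> PP n U" and "(j, k, l) \<in> PP n U" and "(m, q, r) \<in> PP n U"
  shows "(g, bracket n U g h i k l, l) \<in> PP n U \<and>
         is_basis_family (PP n U)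
           (BB n U x :: _ \<Rightarrow> (nat \<Rightarrow> 'u) \<Rightarrow> (nat \<Rightarrow> 'u) \<Rightarrow> 'f::field) (TT n U x) \<and>
         mat.representation (BB n U x ` PP n U)
           (mat_mul (XX n U) (BB n U x (g, h, i)) (BB n U x (j, k, l)))
           (BB n U x (m, q, r) :: (nat \<Rightarrow> 'u) \<Rightarrow> (nat \<Rightarrow> 'u) \<Rightarrow> 'f)
         = of_bool (i = j) * of_bool (m = g) * of_bool (q = bracket n U g h i k l) *
           of_bool (r = l) * of_nat (valency n U (meet3 n h i k))"
proof -
  interpret terwilliger n U x
    using assms(2-4) by unfold_locales
  let ?b = "(g, bracket n U g h i k l, l)"
  let ?BB = "BB n U x :: _ \<Rightarrow> (nat \<Rightarrow> 'u) \<Rightarrow> (nat \<Rightarrow> 'u) \<Rightarrow> 'f"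
  have b: "?b \<in> P" using bracket_in_P assms(5,6) by blast
  \<comment> \<open>\<open>representation\<close> is indexed by matrices; injectivity turns equality
    of matrices into equality of triples, that is, into the three deltas for \<open>m\<close>,
    \<open>q\<close>, \<open>r\<close>.\<close>
  have eq: "?BB ?b = ?BB (m, q, r) \<longleftrightarrow> ?b = (m, q, r)"
    using inj_on_eq_iff[OF BB_inj b assms(7)] .
  \<comment> \<open>\<open>representation\<close> defaults to zero unless the family is independent
    and the vector lies in its span; both are supplied before the scalar is pulled out.\<close>
  have "mat.representation (?BB ` P) (mat_mul X (?BB (g, h, i)) (?BB (j, k, l))) (?BB (m, q, r)) =
      of_bool (i = j) * of_nat (valency n U (meet3 n h i k)) *
      mat.representation (?BB ` P) (?BB ?b) (?BB (m, q, r))"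
    unfolding BB_mul[OF assms(5,6)]
    using b by (subst mat.representation_scale) (auto simp: BB_independent intro: mat.span_base)
  also have "mat.representation (?BB ` P) (?BB ?b) = (\<lambda>M. if M = ?BB ?b then 1 else 0)"
    by (rule mat.representation_basis[OF BB_independent imageI[OF b]])
  also have "(if ?BB (m, q, r) = ?BB ?b then 1 else 0) = of_bool (?b = (m, q, r))"
    using eq by auto
  finally show ?thesis
    using b BB_inj BB_independent BBspan_eq_TT by (auto simp: is_basis_family_def)
qed

end
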